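(* Let $\mathbb{F}$ be a field, let $(S_1,m_1),\dots,(S_n,m_n)$ be nonempty finite multisets of elements of $\mathbb{F}$ of sizes $d_1,\dots,d_n$, let $S=S_1\times\cdots\times S_n$, and let $\mathbf{t}=(t_1,\dots,t_n)=(d_1-1,\dots,d_n-1)$. (a) There exist constants $\alpha^{(\mathbf{s})}_{\mathbf{u}}\in\mathbb{F}$, for $\mathbf{s}\in S$ and $\mathbf{u}\in\mathbb{N}^n$ with $\mathbf{u}<m(\mathbf{s})$, independent of $f$, such that $$f_{\mathbf{t}}=\sum_{\mathbf{s}\in S}\ \sum_{\mathbf{u}<m(\mathbf{s})}\alpha^{(\mathbf{s})}_{\mathbf{u}}\,f_{\mathbf{u}}(\mathbf{s})$$ holds for all polynomials $f\in\mathbb{F}[x_1,\dots,x_n]$ with $\deg f\le t_1+\cdots+t_n$. (b) The coefficients $\alpha^{(\mathbf{s})}_{\mathbf{u}}$ are uniquely determined (by the multisets, $\mathbf{s}$, $\mathbf{t}$ and $\mathbf{u}$): any two families of constants with the property in (a) coincide. (c) If $\mathbf{s}\in S$ and $\mathbf{u}=m(\mathbf{s})-\mathbf{1}$, then $\alpha^{(\mathbf{s})}_{\mathbf{u}}\neq 0$.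
   Context: A finite multiset $(S_i,m_i)$ of elements of $\mathbb{F}$ is a finite subset $S_i\subseteq\mathbb{F}$ together with a positive integer multiplicity $m_i(s)$ for each $s\in S_i$; it is nonempty if $S_i\neq\emptyset$. Its size is $d_i=\sum_{s\in S_i}m_i(s)$. For $\mathbf{s}=(s_1,\dots,s_n)\in S$ put $m(\mathbf{s})=(m_1(s_1),\dots,m_n(s_n))$. $\mathbf{1}=(1,\dots,1)$, and $\mathbf{u}<\mathbf{w}$ means $u_i<w_i$ for every $i$. $\mathbb{N}$ is the set of nonnegative integers. For $\mathbf{s}\in\mathbb{F}^n$ and $\mathbf{u}\in\mathbb{N}^n$, $(\mathbf{x}-\mathbf{s})^{\mathbf{u}}=\prod_{i=1}^n(x_i-s_i)^{u_i}$. Every $f\in\mathbb{F}[x_1,\dots,x_n]$ has a unique expansion $f(\mathbf{x})=\sum_{\mathbf{u}\in\mathbb{N}^n}f_{\mathbf{u}}(\mathbf{s})(\mathbf{x}-\mathbf{s})^{\mathbf{u}}$ with $f_{\mathbf{u}}(\mathbf{s})\in\mathbb{F}$; this defines $f_{\mathbf{u}}(\mathbf{s})$. If $u_1+\cdots+u_n\ge\deg f$ (total degree), then $f_{\mathbf{u}}(\mathbf{s})$ does not depend on $\mathbf{s}$ and is written $f_{\mathbf{u}}$; in particular, for $\deg f\le t_1+\cdots+t_n$, $f_{\mathbf{t}}$ is the coefficient of $x_1^{t_1}\cdots x_n^{t_n}$ in $f$. *)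

theory Defs
  imports "HOL-Library.Poly_Mapping" "HOL-Library.Multiset" "HOL-Library.FuncSet"
begin

text \<open>
  The polynomial ring F[x_1, ..., x_n] is rendered as the monoid ring of the free commutative
  monoid of exponent vectors: the variables are indexed by a finite type 'n (with n elements),
  an element of N^n is a finitely supported map from 'n to nat, and a polynomial f is a
  finitely supported map from exponent vectors to coefficients. Its ring structure is the library's convolution
  product, and lookup f u is the coefficient of x^u.
\<close>

type_synonym ('n, 'a) mvpoly = "('n \<Rightarrow>\<^sub>0 nat) \<Rightarrow>\<^sub>0 'a"

definition Const :: "'a::field \<Rightarrow> ('n::finite, 'a) mvpoly" where
  "Const a = Poly_Mapping.single 0 a"

definition Var :: "'n::finite \<Rightarrow> ('n, 'a::field) mvpoly" where
  "Var i = Poly_Mapping.single (Poly_Mapping.single i 1) 1"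

definition exp_sum :: "('n::finite \<Rightarrow>\<^sub>0 nat) \<Rightarrow> nat" where
  "exp_sum u = (\<Sum>i\<in>UNIV. Poly_Mapping.lookup u i)"

text \<open>With this convention the zero polynomial has degree 0.\<close>

definition total_degree :: "('n::finite, 'a::field) mvpoly \<Rightarrow> nat" where
  "total_degree f = Max (insert 0 (exp_sum ` Poly_Mapping.keys f))"

text \<open>The polynomial (x - s)^u.\<close>

definition shifted_monom :: "('n::finite \<Rightarrow> 'a::field) \<Rightarrow> ('n \<Rightarrow>\<^sub>0 nat) \<Rightarrow> ('n, 'a) mvpoly" where
  "shifted_monom s u = (\<Prod>i\<in>UNIV. (Var i - Const (s i)) ^ Poly_Mapping.lookup u i)"

definition shifted_sum :: "('n::finite \<Rightarrow> 'a::field) \<Rightarrow> (('n \<Rightarrow>\<^sub>0 nat) \<Rightarrow>\<^sub>0 'a) \<Rightarrow> ('n, 'a) mvpoly" where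
  "shifted_sum s c = (\<Sum>u\<in>Poly_Mapping.keys c. Const (Poly_Mapping.lookup c u) * shifted_monom s u)"

text \<open>
  The coefficient f_u(s) in the unique expansion of f in powers of x - s; existence and
  uniqueness of the expansion are proved in \<open>shifted_expansion_unique\<close> below.
\<close>

definition shifted_coeff :: "('n::finite, 'a::field) mvpoly \<Rightarrow> ('n \<Rightarrow>\<^sub>0 nat) \<Rightarrow> ('n \<Rightarrow> 'a) \<Rightarrow> 'a" where
  "shifted_coeff f u s = Poly_Mapping.lookup (THE c. f = shifted_sum s c) u"

text \<open>
  A finite multiset (S_i, m_i) is a value M i of the library's multiset type: S_i is its
  underlying set, m_i its count function, d_i its size.
\<close>

definition grid :: "('n::finite \<Rightarrow> 'a multiset) \<Rightarrow> ('n \<Rightarrow> 'a) set" where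
  "grid M = Pi UNIV (\<lambda>i. set_mset (M i))"

definition below_mult :: "('n::finite \<Rightarrow> 'a multiset) \<Rightarrow> ('n \<Rightarrow> 'a) \<Rightarrow> ('n \<Rightarrow>\<^sub>0 nat) set" where
  "below_mult M s = {u. \<forall>i. Poly_Mapping.lookup u i < count (M i) (s i)}"

text \<open>
  The property of the family of constants \<open>\<alpha>\<close>. Only the values \<open>\<alpha> s u\<close> with s in the grid and
  u < m(s) matter; all others are irrelevant.
\<close>

definition coefficient_formula ::
  "('n::finite \<Rightarrow> 'a::field multiset) \<Rightarrow> ('n \<Rightarrow>\<^sub>0 nat) \<Rightarrow> (('n \<Rightarrow> 'a) \<Rightarrow> ('n \<Rightarrow>\<^sub>0 nat) \<Rightarrow> 'a) \<Rightarrow> bool" where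
  "coefficient_formula M t \<alpha> \<longleftrightarrow>
     (\<forall>f :: ('n, 'a) mvpoly. total_degree f \<le> exp_sum t \<longrightarrow>
        Poly_Mapping.lookup f t =
          (\<Sum>s\<in>grid M. \<Sum>u\<in>below_mult M s. \<alpha> s u * shifted_coeff f u s))"


text \<open>
  Well-definedness: the expansion exists and is unique, both index sets above are finite, and
  f_u(s) is the coefficient of x^u in f, independently of s, when the degree of f is at most
  u_1 + ... + u_n.
\<close>

definition monic_at :: "('n::finite, 'a::field) mvpoly \<Rightarrow> ('n \<Rightarrow>\<^sub>0 nat) \<Rightarrow> bool" where
  "monic_at p u \<longleftrightarrow> (\<forall>v. exp_sum u \<le> exp_sum v \<longrightarrow> Poly_Mapping.lookup p v = (1 when v = u))"

lemma exp_sum_add: "exp_sum (u + v) = exp_sum u + exp_sum v"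
  by (simp add: exp_sum_def lookup_add sum.distrib)

lemma monic_at_iff:
  "monic_at p u \<longleftrightarrow> (\<forall>v\<in>Poly_Mapping.keys (p - Poly_Mapping.single u 1). exp_sum v < exp_sum u)"
proof -
  have "Poly_Mapping.lookup (p - Poly_Mapping.single u 1) v = Poly_Mapping.lookup p v - (1 when v = u)" for v
    by (simp add: lookup_minus lookup_single when_def eq_commute)
  then show ?thesis
    unfolding monic_at_def Ball_def in_keys_iff not_le[symmetric] by auto
qed

lemma monic_at_mult:
  assumes "monic_at p u" "monic_at q w"
  shows "monic_at (p * q) (u + w)"
proof -
  let ?X = "Poly_Mapping.single u 1" and ?Y = "Poly_Mapping.single w 1"
  define p' where "p' = p - ?X"
  define q' where "q' = q - ?Y"
  have p': "\<forall>v\<in>Poly_Mapping.keys p'. exp_sum v < exp_sum u"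
    unfolding p'_def by (rule iffD1[OF monic_at_iff assms(1)])
  have q': "\<forall>v\<in>Poly_Mapping.keys q'. exp_sum v < exp_sum w"
    unfolding q'_def by (rule iffD1[OF monic_at_iff assms(2)])
  have "p * q - Poly_Mapping.single (u + w) 1 = p' * ?Y + (?X * q' + p' * q')"
    by (simp add: p'_def q'_def algebra_simps mult_single)
  moreover have "Poly_Mapping.keys (p' * ?Y + (?X * q' + p' * q')) \<subseteq>
      Poly_Mapping.keys (p' * ?Y) \<union> (Poly_Mapping.keys (?X * q') \<union> Poly_Mapping.keys (p' * q'))"
    by (rule order_trans[OF keys_add Un_mono[OF order_refl keys_add]])
  moreover have "\<forall>v\<in>Poly_Mapping.keys (p' * ?Y). exp_sum v < exp_sum (u + w)"
    using p' keys_mult[of p' ?Y] by (force simp: exp_sum_add)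
  moreover have "\<forall>v\<in>Poly_Mapping.keys (?X * q'). exp_sum v < exp_sum (u + w)"
    using q' keys_mult[of ?X q'] by (force simp: exp_sum_add)
  moreover have "\<forall>v\<in>Poly_Mapping.keys (p' * q'). exp_sum v < exp_sum (u + w)"
    using p' q' keys_mult[of p' q'] by (force simp: exp_sum_add intro: add_strict_mono)
  ultimately show ?thesis
    unfolding monic_at_iff by (simp only:) blast
qed

lemma monic_at_one: "monic_at 1 0"
  by (auto simp: monic_at_def lookup_one)

lemma monic_at_linear:
  fixes i :: "'n::finite" and a :: "'a::field"
  shows "monic_at (Var i - Const a) (Poly_Mapping.single i 1)"
proof -
  have "exp_sum (Poly_Mapping.single i 1) = 1"
    by (simp add: exp_sum_def lookup_single when_def)
  moreover have "exp_sum (0 :: 'n \<Rightarrow>\<^sub>0 nat) = 0"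
    by (simp add: exp_sum_def)
  ultimately show ?thesis
    by (auto simp: monic_at_def Var_def Const_def lookup_minus lookup_single when_def)
qed

lemma monic_at_linear_power:
  "monic_at ((Var i - Const a) ^ k) (Poly_Mapping.single i k)"
proof (induction k)
  case 0
  show ?case by (simp add: monic_at_one)
next
  case (Suc k)
  have "Poly_Mapping.single i (Suc k) = Poly_Mapping.single i 1 + Poly_Mapping.single i k"
    using single_add[of i 1 k] by simp
  then show ?case
    by (simp only: power_Suc monic_at_mult[OF monic_at_linear Suc.IH])
qed

lemma sum_single_lookup:
  fixes u :: "'n::finite \<Rightarrow>\<^sub>0 nat"
  shows "(\<Sum>i\<in>UNIV. Poly_Mapping.single i (Poly_Mapping.lookup u i)) = u"
proof (rule poly_mapping_eqI)
  fix k
  have "(\<Sum>i\<in>UNIV. Poly_Mapping.lookup (Poly_Mapping.single i (Poly_Mapping.lookup u i)) k) =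
      (\<Sum>i\<in>UNIV. if i = k then Poly_Mapping.lookup u i else 0)"
    by (intro sum.cong refl) (auto simp: lookup_single)
  also have "\<dots> = Poly_Mapping.lookup u k"
    by (subst sum.delta) auto
  finally show "Poly_Mapping.lookup (\<Sum>i\<in>UNIV. Poly_Mapping.single i (Poly_Mapping.lookup u i)) k
      = Poly_Mapping.lookup u k"
    by (simp only: lookup_sum)
qed

lemma monic_at_prod:
  assumes "finite I"
  shows "monic_at (\<Prod>i\<in>I. (Var i - Const (s i)) ^ Poly_Mapping.lookup u i)
    (\<Sum>i\<in>I. Poly_Mapping.single i (Poly_Mapping.lookup u i))"
  using assms
proof (induction I)
  case empty
  show ?case by (simp add: monic_at_one)
next
  case (insert i I)
  show ?case
    unfolding prod.insert[OF insert.hyps] sum.insert[OF insert.hyps]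
    by (rule monic_at_mult[OF monic_at_linear_power insert.IH])
qed

lemma monic_at_shifted_monom: "monic_at (shifted_monom s u) u"
  using monic_at_prod[OF finite_class.finite_UNIV, of s u]
  unfolding shifted_monom_def sum_single_lookup .

lemma shifted_sum_superset:
  assumes "finite K" "Poly_Mapping.keys c \<subseteq> K"
  shows "shifted_sum s c = (\<Sum>u\<in>K. Const (Poly_Mapping.lookup c u) * shifted_monom s u)"
  unfolding shifted_sum_def using assms
  by (intro sum.mono_neutral_left) (auto simp: in_keys_iff Const_def)

lemma shifted_sum_add: "shifted_sum s (c + d) = shifted_sum s c + shifted_sum s d"
proof -
  let ?K = "Poly_Mapping.keys c \<union> Poly_Mapping.keys d"
  have fin: "finite ?K" by simp
  show ?thesis
    using shifted_sum_superset[OF fin, of c s] shifted_sum_superset[OF fin, of d s]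
      shifted_sum_superset[OF fin keys_add, of s]
    by (simp add: lookup_add Const_def single_add algebra_simps sum.distrib)
qed

lemma shifted_sum_diff: "shifted_sum s (c - d) = shifted_sum s c - shifted_sum s d"
  using shifted_sum_add[of s "c - d" d] by simp

lemma lookup_Const_mult:
  "Poly_Mapping.lookup (Const a * p) v = a * Poly_Mapping.lookup p v"
  unfolding Const_def mult_map_scale_conv_mult[symmetric]
  by (transfer) (simp add: when_def)

lemma lookup_shifted_sum:
  assumes "\<And>u. u \<in> Poly_Mapping.keys c \<Longrightarrow> exp_sum u \<le> exp_sum v"
  shows "Poly_Mapping.lookup (shifted_sum s c) v = Poly_Mapping.lookup c v"
proof -
  have "Poly_Mapping.lookup (shifted_sum s c) v =
      (\<Sum>u\<in>Poly_Mapping.keys c. Poly_Mapping.lookup c u * (1 when v = u))"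
    using monic_at_shifted_monom[of s] assms
    by (auto simp: shifted_sum_def lookup_sum lookup_Const_mult monic_at_def intro!: sum.cong)
  also have "\<dots> = Poly_Mapping.lookup c v"
    by (simp add: when_def in_keys_iff sum.delta' if_distrib cong: if_cong)
  finally show ?thesis .
qed

lemma obtain_max_key:
  assumes "c \<noteq> 0"
  obtains v where "v \<in> Poly_Mapping.keys c"
    "\<And>u. u \<in> Poly_Mapping.keys c \<Longrightarrow> exp_sum u \<le> exp_sum v"
proof -
  let ?E = "exp_sum ` Poly_Mapping.keys c"
  have fin: "finite ?E" by simp
  have "Poly_Mapping.keys c \<noteq> {}"
    using assms by simp
  then have "Max ?E \<in> ?E"
    by (intro Max_in fin) simp
  then obtain v where v: "v \<in> Poly_Mapping.keys c" "Max ?E = exp_sum v"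
    by (rule imageE) auto
  have "exp_sum u \<le> exp_sum v" if "u \<in> Poly_Mapping.keys c" for u
    using Max_ge[OF fin imageI[OF that]] v(2) by simp
  with v(1) show ?thesis by (rule that)
qed

theorem shifted_expansion_unique: "\<exists>!c. f = shifted_sum s c"
proof (rule ex_ex1I)
  have "\<exists>c. g = shifted_sum s c" if "\<forall>v\<in>Poly_Mapping.keys g. exp_sum v < N" for g N
    using that
  proof (induction N arbitrary: g)
    case 0
    then have "g = 0" by (metis all_not_in_conv keys_eq_empty not_less_zero)
    then have "g = shifted_sum s 0" by (simp add: shifted_sum_def)
    then show ?case ..
  next
    case (Suc N)
    have "\<forall>v\<in>Poly_Mapping.keys (g - shifted_sum s g). exp_sum v < N"
    proof (rule ccontr)
      assume "\<not> ?thesis"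
      then obtain v where v: "v \<in> Poly_Mapping.keys (g - shifted_sum s g)" "N \<le> exp_sum v"
        by (auto simp: not_less)
      have "exp_sum u \<le> exp_sum v" if "u \<in> Poly_Mapping.keys g" for u
        using Suc.prems that v(2) by fastforce
      then have "Poly_Mapping.lookup (shifted_sum s g) v = Poly_Mapping.lookup g v"
        by (rule lookup_shifted_sum)
      then show False
        using v(1) by (simp add: in_keys_iff lookup_minus)
    qed
    then obtain c where "g - shifted_sum s g = shifted_sum s c"
      using Suc.IH by blast
    then have "g = shifted_sum s (g + c)"
      by (simp add: shifted_sum_add algebra_simps)
    then show ?case ..
  qed
  moreover have "\<forall>v\<in>Poly_Mapping.keys f. exp_sum v < Suc (total_degree f)"
    by (simp add: total_degree_def less_Suc_eq_le)
  ultimately show "\<exists>c. f = shifted_sum s c" by blast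
next
  fix c d assume "f = shifted_sum s c" "f = shifted_sum s d"
  then have eq: "shifted_sum s (c - d) = 0" by (simp add: shifted_sum_diff)
  show "c = d"
  proof (rule ccontr)
    assume "c \<noteq> d"
    then obtain v where v: "v \<in> Poly_Mapping.keys (c - d)"
      "\<And>u. u \<in> Poly_Mapping.keys (c - d) \<Longrightarrow> exp_sum u \<le> exp_sum v"
      by (metis obtain_max_key right_minus_eq)
    have "Poly_Mapping.lookup (shifted_sum s (c - d)) v = Poly_Mapping.lookup (c - d) v"
      by (rule lookup_shifted_sum) (rule v(2))
    then show False
      using v(1) eq by (simp add: in_keys_iff)
  qed
qed

theorem shifted_coeff_eq_lookup:
  assumes "total_degree f \<le> exp_sum u"
  shows "shifted_coeff f u s = Poly_Mapping.lookup f u"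
proof -
  define c where "c = (THE c. f = shifted_sum s c)"
  have f: "f = shifted_sum s c"
    unfolding c_def by (rule theI'[OF shifted_expansion_unique])
  have "exp_sum w \<le> exp_sum u" if w: "w \<in> Poly_Mapping.keys c" for w
  proof -
    have "c \<noteq> 0" using w by auto
    then obtain v where v: "v \<in> Poly_Mapping.keys c"
      "\<And>u. u \<in> Poly_Mapping.keys c \<Longrightarrow> exp_sum u \<le> exp_sum v"
      using obtain_max_key by blast
    have "Poly_Mapping.lookup (shifted_sum s c) v = Poly_Mapping.lookup c v"
      by (rule lookup_shifted_sum) (rule v(2))
    then have "v \<in> Poly_Mapping.keys f"
      using v(1) f by (simp add: in_keys_iff)
    then have "exp_sum v \<le> total_degree f"
      by (simp add: total_degree_def)
    then show ?thesis using v(2)[OF w] assms by linarith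
  qed
  then have "Poly_Mapping.lookup (shifted_sum s c) u = Poly_Mapping.lookup c u"
    by (rule lookup_shifted_sum)
  then show ?thesis
    by (simp only: shifted_coeff_def flip: c_def f)
qed

lemma finite_grid: "finite (grid M)"
proof -
  have "grid M = PiE UNIV (\<lambda>i. set_mset (M i))"
    by (simp add: grid_def PiE_def)
  then show ?thesis
    by (simp add: finite_PiE)
qed

lemma finite_below_mult: "finite (below_mult M s)"
proof -
  have "inj_on Poly_Mapping.lookup (below_mult M s)"
    by (intro inj_onI poly_mapping_eqI) (rule fun_cong)
  moreover have "Poly_Mapping.lookup ` below_mult M s \<subseteq> PiE UNIV (\<lambda>i. {..<count (M i) (s i)})"
    by (auto simp: below_mult_def)
  moreover have "finite (PiE UNIV (\<lambda>i. {..<count (M i) (s i)}))"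
    by (intro finite_PiE) auto
  ultimately show ?thesis
    by (meson finite_imageD finite_subset)
qed

end

theory Submission
  imports Defs "HOL-Computational_Algebra.Polynomial"
begin

text \<open>
  In one variable, the formula exists because Hermite interpolation is unique: a polynomial of
  degree less than the size of a multiset \<open>A\<close> whose Taylor coefficients at each point of \<open>A\<close>
  vanish up to the multiplicity of that point has more roots than its degree allows, hence is zero
  (\<open>zero_if_taylor_coeffs_vanish\<close>). So the coefficient of top degree, like every linear functional
  on these polynomials, is a linear combination of the prescribed Taylor coefficients
  (\<open>univariate_coefficient_formula\<close>, from \<open>functional_in_span\<close>).

  In several variables, existence comes from multiplying the univariate formulas. The constants
  \<open>\<alpha> s u = (\<Prod>i. \<alpha>_i (s_i) (u_i))\<close> work for a monomial \<open>x^v\<close> of degree at most the sum of the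
  \<open>t_i\<close>, because the right-hand side then factors over the variables. Factor \<open>i\<close> is under control
  only if \<open>v_i \<le> t_i\<close>, but a monomial other than \<open>x^t\<close> within the degree bound has some
  \<open>v_i < t_i\<close>, and this one factor already vanishes, whatever the others are. Linearity extends
  the formula to all polynomials within the degree bound (\<open>coefficient_formula_product\<close>).

  Uniqueness and nonvanishing use the test polynomials
  \<open>(x - s)^u * (\<Prod>i. \<Prod>b\<in>S_i - {s_i}. (x_i - b)^(m_i b))\<close> for a grid point \<open>s\<close> and
  \<open>u < m(s)\<close>. They obey the degree bound, kill every prescribed coefficient at the other grid
  points, and at \<open>s\<close> they start with a nonzero coefficient at \<open>u\<close>. Applied to them, the right-hand
  side is triangular in the constants belonging to \<open>s\<close> (\<open>sum_grid_test\<close>): this makes the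
  difference of two solutions vanish, from the top exponents down. For \<open>u = m(s) - 1\<close> the sum
  retains a single term, while the test polynomial has coefficient 1 at \<open>x^t\<close>, so that the
  corresponding constant cannot be 0.
\<close>

section \<open>Linear functionals with a common kernel\<close>

text \<open>
  Induction on \<open>I\<close>: either \<open>L i\<close> already vanishes on the common kernel of the other functionals
  and is redundant, or some \<open>z\<close> in that kernel has \<open>L i z \<noteq> 0\<close>, and subtracting the multiple of
  \<open>L i\<close> that agrees with \<open>\<phi>\<close> at \<open>z\<close> reduces the claim to the others. The claim
  is relative to a subspace because the application needs it for polynomials of bounded degree;
  among all polynomials the common kernel there is too large.
\<close>

lemma (in vector_space) functional_in_span:
  assumes "finite I" and V: "subspace V"
    and add: "\<And>i x y. x \<in> V \<Longrightarrow> y \<in> V \<Longrightarrow> L i (x + y) = L i x + L i y"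
    and scale: "\<And>i c x. x \<in> V \<Longrightarrow> L i (c *s x) = c * L i x"
    and "\<And>x y. x \<in> V \<Longrightarrow> y \<in> V \<Longrightarrow> \<phi> (x + y) = \<phi> x + \<phi> y"
    and "\<And>c x. x \<in> V \<Longrightarrow> \<phi> (c *s x) = c * \<phi> x"
    and "\<And>x. x \<in> V \<Longrightarrow> \<forall>i\<in>I. L i x = 0 \<Longrightarrow> \<phi> x = 0"
  shows "\<exists>\<alpha>. \<forall>x\<in>V. \<phi> x = (\<Sum>i\<in>I. \<alpha> i * L i x)"
  using \<open>finite I\<close> assms(5-7)
proof (induction I arbitrary: \<phi>)
  case empty
  then show ?case by simp
next
  case (insert i I)
  show ?case
  proof (cases "\<forall>x\<in>V. (\<forall>j\<in>I. L j x = 0) \<longrightarrow> L i x = 0")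
    case True
    then have "\<exists>\<alpha>. \<forall>x\<in>V. \<phi> x = (\<Sum>j\<in>I. \<alpha> j * L j x)"
      using insert.prems by (intro insert.IH) auto
    then obtain \<alpha> where \<alpha>: "\<forall>x\<in>V. \<phi> x = (\<Sum>j\<in>I. \<alpha> j * L j x)" ..
    have "\<forall>x\<in>V. \<phi> x = (\<Sum>j\<in>insert i I. (\<alpha>(i := 0)) j * L j x)"
      using \<alpha> insert.hyps by (auto intro!: sum.cong)
    then show ?thesis by blast
  next
    case False
    then obtain z where z: "z \<in> V" "\<forall>j\<in>I. L j z = 0" "L i z \<noteq> 0" by blast
    define c where "c = \<phi> z / L i z"
    have "\<exists>\<alpha>. \<forall>x\<in>V. \<phi> x - c * L i x = (\<Sum>j\<in>I. \<alpha> j * L j x)"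
    proof (rule insert.IH)
      fix x assume x: "x \<in> V" "\<forall>j\<in>I. L j x = 0"
      \<comment> \<open>Subtracting the multiple of \<open>z\<close> with the same value of \<open>L i\<close> moves \<open>x\<close> into the
        common kernel of all the functionals.\<close>
      let ?k = "- (L i x / L i z)"
      have kz: "?k *s z \<in> V" using z(1) V by (rule subspace_scale[rotated])
      have "\<phi> (x + ?k *s z) = 0"
      proof (rule insert.prems(3))
        show "x + ?k *s z \<in> V" using x(1) kz V by (intro subspace_add)
        show "\<forall>j\<in>insert i I. L j (x + ?k *s z) = 0"
          unfolding add[OF x(1) kz] scale[OF z(1)] using x(2) z(2,3) by simp
      qed
      then have "\<phi> x + ?k * \<phi> z = 0"
        using insert.prems(1)[OF x(1) kz] insert.prems(2)[OF z(1), of ?k] by simp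
      then show "\<phi> x - c * L i x = 0"
        by (simp add: c_def mult.commute)
    qed (use insert.prems add scale in \<open>auto simp: algebra_simps\<close>)
    then obtain \<alpha> where \<alpha>: "\<forall>x\<in>V. \<phi> x - c * L i x = (\<Sum>j\<in>I. \<alpha> j * L j x)" ..
    have "\<phi> x = (\<Sum>j\<in>insert i I. (\<alpha>(i := c)) j * L j x)" if "x \<in> V" for x
    proof -
      have "\<phi> x = c * L i x + (\<Sum>j\<in>I. \<alpha> j * L j x)"
        using \<alpha> that by (metis add.commute diff_add_cancel)
      also have "(\<Sum>j\<in>I. \<alpha> j * L j x) = (\<Sum>j\<in>I. (\<alpha>(i := c)) j * L j x)"
        using insert.hyps by (intro sum.cong) auto
      finally show ?thesis using insert.hyps by simp
    qed
    then show ?thesis by blast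
  qed
qed

section \<open>Hermite interpolation in one variable\<close>

definition taylor_coeff :: "'a::field poly \<Rightarrow> 'a \<Rightarrow> nat \<Rightarrow> 'a" where
  "taylor_coeff p a j = coeff (pcompose p [:a, 1:]) j"

lemma taylor_coeff_0: "taylor_coeff p 0 j = coeff p j"
  by (simp add: taylor_coeff_def)

lemma taylor_coeff_at_0: "taylor_coeff p a 0 = poly p a"
  by (simp add: taylor_coeff_def poly_pcompose flip: poly_0_coeff_0)

lemma taylor_coeff_eq_0: "degree p < j \<Longrightarrow> taylor_coeff p a j = 0"
  by (simp add: taylor_coeff_def coeff_eq_0 degree_pcompose)

text \<open>
  Translation by \<open>a\<close> is invertible and turns powers of \<open>x - a\<close> into powers of \<open>x\<close>; this reduces
  divisibility by \<open>(x - a)^m\<close> to the vanishing of low-order coefficients.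
\<close>

lemma pcompose_shift_cancel:
  "pcompose (pcompose p [:a, 1:]) [:- a, 1:] = (p :: 'a::field poly)"
  by (simp flip: pcompose_assoc add: pcompose_pCons)

lemma pcompose_linear_power:
  "pcompose ([:- a, 1:] ^ m) [:a, 1:] = (monom 1 m :: 'a::field poly)"
  "pcompose (monom 1 m) [:- a, 1:] = ([:- a, 1:] ^ m :: 'a::field poly)"
proof -
  have "pcompose (p ^ m) q = pcompose p q ^ m" for p q :: "'a poly"
    by (induction m) (simp_all add: pcompose_mult pcompose_1)
  then show "pcompose ([:- a, 1:] ^ m) [:a, 1:] = (monom 1 m :: 'a poly)"
    and "pcompose (monom 1 m) [:- a, 1:] = ([:- a, 1:] ^ m :: 'a poly)"
    by (simp_all add: monom_altdef pcompose_pCons)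
qed

lemma taylor_coeff_linear_power_mult:
  "taylor_coeff ([:- a, 1:] ^ m * q) a j = (if j < m then 0 else taylor_coeff q a (j - m))"
  by (simp add: taylor_coeff_def pcompose_mult pcompose_linear_power coeff_monom_mult)

lemma linear_power_dvd_iff_taylor_coeff:
  "[:- a, 1:] ^ m dvd p \<longleftrightarrow> (\<forall>j<m. taylor_coeff p a j = 0)"
proof
  assume "[:- a, 1:] ^ m dvd p"
  then show "\<forall>j<m. taylor_coeff p a j = 0"
    by (auto elim!: dvdE simp: taylor_coeff_linear_power_mult)
next
  assume "\<forall>j<m. taylor_coeff p a j = 0"
  then have "monom 1 m dvd pcompose p [:a, 1:]"
    by (simp add: monom_1_dvd_iff' taylor_coeff_def)
  then obtain q where "pcompose p [:a, 1:] = monom 1 m * q" ..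
  then have "p = [:- a, 1:] ^ m * pcompose q [:- a, 1:]"
    by (metis pcompose_shift_cancel pcompose_mult pcompose_linear_power(2))
  then show "[:- a, 1:] ^ m dvd p" by simp
qed

text \<open>
  Each point of \<open>A\<close> is a root of at least its multiplicity in \<open>A\<close>, so if \<open>p\<close> were nonzero then
  \<open>A\<close> would be contained in its multiset of roots, whose size is at most the degree.
\<close>

lemma zero_if_taylor_coeffs_vanish:
  fixes A :: "'a::field multiset"
  assumes "degree p < size A"
    and "\<And>a j. a \<in># A \<Longrightarrow> j < count A a \<Longrightarrow> taylor_coeff p a j = 0"
  shows "p = 0"
proof (rule ccontr)
  assume "p \<noteq> 0"
  have "count A a \<le> order a p" for a
  proof (cases "a \<in># A")
    case True
    then have "[:- a, 1:] ^ count A a dvd p"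
      using assms(2) by (simp add: linear_power_dvd_iff_taylor_coeff)
    with \<open>p \<noteq> 0\<close> show ?thesis by (simp add: order_divides)
  qed (simp add: not_in_iff)
  then have "A \<subseteq># proots p"
    using \<open>p \<noteq> 0\<close> by (simp add: subseteq_mset_def)
  then have "size A \<le> degree p"
    using size_mset_mono size_proots_le order_trans by blast
  with assms(1) show False by simp
qed

lemma univariate_coefficient_formula:
  fixes A :: "'a::field multiset"
  assumes "A \<noteq> {#}"
  shows "\<exists>\<alpha>. \<forall>p. degree p < size A \<longrightarrow>
    coeff p (size A - 1) = (\<Sum>a\<in>set_mset A. \<Sum>j<count A a. \<alpha> a j * taylor_coeff p a j)"
proof -
  interpret vector_space "smult :: 'a \<Rightarrow> 'a poly \<Rightarrow> 'a poly"
    by unfold_locales (simp_all add: smult_add_right smult_add_left)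
  let ?V = "{p :: 'a poly. degree p < size A}"
  let ?I = "SIGMA a : set_mset A. {..<count A a}"
  have "\<exists>\<alpha>. \<forall>p\<in>?V. coeff p (size A - 1)
      = (\<Sum>k\<in>?I. \<alpha> k * taylor_coeff p (fst k) (snd k))"
  proof (rule functional_in_span)
    show "subspace ?V"
      unfolding subspace_def using assms
      by (auto simp: nonempty_has_size intro: degree_add_less le_less_trans[OF degree_smult_le])
  next
    fix p assume "p \<in> ?V" "\<forall>k\<in>?I. taylor_coeff p (fst k) (snd k) = 0"
    then have "p = 0"
      by (intro zero_if_taylor_coeffs_vanish[of p A]) auto
    then show "coeff p (size A - 1) = 0" by simp
  qed (auto simp: taylor_coeff_def pcompose_add pcompose_smult)
  then obtain \<alpha> where "\<forall>p\<in>?V. coeff p (size A - 1)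
      = (\<Sum>k\<in>?I. \<alpha> k * taylor_coeff p (fst k) (snd k))" ..
  then have "\<forall>p. degree p < size A \<longrightarrow> coeff p (size A - 1)
      = (\<Sum>a\<in>set_mset A. \<Sum>j<count A a. curry \<alpha> a j * taylor_coeff p a j)"
    by (simp add: sum.Sigma split_def)
  then show ?thesis by blast
qed

text \<open>
  For fixed \<open>a\<close> and varying \<open>k\<close>, these polynomials are invisible to the data at the other
  points of \<open>A\<close>, and their data at \<open>a\<close> are triangular in \<open>k\<close> with nonzero diagonal. They are
  not the dual basis of Hermite interpolation, whose explicit form is more involved;
  triangularity suffices for uniqueness.
\<close>

definition hermite_test :: "'a::field multiset \<Rightarrow> 'a \<Rightarrow> nat \<Rightarrow> 'a poly" where
  "hermite_test A a k =
     [:- a, 1:] ^ k * (\<Prod>b\<in>set_mset A - {a}. [:- b, 1:] ^ count A b)"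

lemma degree_hermite_test: "degree (hermite_test A a k) + count A a = k + size A"
proof -
  have "degree (hermite_test A a k) = k + (\<Sum>b\<in>set_mset A - {a}. count A b)"
    unfolding hermite_test_def
    by (simp add: degree_mult_eq degree_power_eq degree_prod_eq_sum_degree)
  moreover have "size A = count A a + (\<Sum>b\<in>set_mset A - {a}. count A b)"
    by (cases "a \<in># A") (simp_all add: size_multiset_overloaded_eq sum.remove not_in_iff)
  ultimately show ?thesis by simp
qed

lemma lead_coeff_hermite_test: "lead_coeff (hermite_test A a k) = 1"
  unfolding hermite_test_def by (simp add: lead_coeff_mult lead_coeff_power lead_coeff_prod)

lemma taylor_coeff_hermite_test_other:
  assumes "b \<in># A" "b \<noteq> a" "j < count A b"
  shows "taylor_coeff (hermite_test A a k) b j = 0"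
proof -
  have "[:- b, 1:] ^ count A b dvd (\<Prod>b\<in>set_mset A - {a}. [:- b, 1:] ^ count A b)"
    using assms by (intro dvd_prodI) auto
  then have "[:- b, 1:] ^ count A b dvd hermite_test A a k"
    unfolding hermite_test_def by (rule dvd_mult)
  with assms(3) show ?thesis by (simp add: linear_power_dvd_iff_taylor_coeff)
qed

lemma taylor_coeff_hermite_test_below:
  "j < k \<Longrightarrow> taylor_coeff (hermite_test A a k) a j = 0"
  by (simp add: hermite_test_def taylor_coeff_linear_power_mult)

lemma taylor_coeff_hermite_test_diag: "taylor_coeff (hermite_test A a k) a k \<noteq> 0"
  by (simp add: hermite_test_def taylor_coeff_linear_power_mult taylor_coeff_at_0 poly_prod)

section \<open>Products of univariate polynomials\<close>

lemma Const_add: "Const (a + b) = Const a + Const b"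
  by (simp add: Const_def single_add)

lemma Const_mult: "Const (a * b) = Const a * Const b"
  by (simp add: Const_def mult_single)

lemma Const_0 [simp]: "Const 0 = 0"
  by (simp add: Const_def)

lemma Const_1 [simp]: "Const 1 = 1"
  by (simp add: Const_def)

lemma Const_prod: "Const (\<Prod>i\<in>I. f i) = (\<Prod>i\<in>I. Const (f i))"
  by (induction I rule: infinite_finite_induct) (simp_all add: Const_mult)

definition subst_poly :: "('n::finite, 'a::field) mvpoly \<Rightarrow> 'a poly \<Rightarrow> ('n, 'a) mvpoly" where
  "subst_poly x p = poly (map_poly Const p) x"

lemma subst_poly_pCons: "subst_poly x (pCons a p) = Const a + x * subst_poly x p"
  by (simp add: subst_poly_def map_poly_pCons)

lemma subst_poly_0 [simp]: "subst_poly x 0 = 0"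
  by (simp add: subst_poly_def)

lemma subst_poly_add: "subst_poly x (p + q) = subst_poly x p + subst_poly x q"
  by (induction p q rule: poly_induct2) (simp_all add: subst_poly_pCons Const_add algebra_simps)

lemma subst_poly_smult: "subst_poly x (smult a p) = Const a * subst_poly x p"
  by (induction p) (simp_all add: subst_poly_pCons Const_mult algebra_simps)

lemma subst_poly_monom: "subst_poly x (monom 1 k) = x ^ k"
  by (induction k) (simp_all add: subst_poly_pCons monom_0 monom_Suc)

lemma subst_poly_shift:
  "subst_poly x p = subst_poly (x - Const a) (pcompose p [:a, 1:])"
  by (induction p)
    (simp_all add: subst_poly_pCons pcompose_pCons subst_poly_add subst_poly_smult algebra_simps)

text \<open>
  Together with \<open>prod_sum_exponents\<close> this is what produces the expansion of a product of univariate
  polynomials in powers of \<open>x - s\<close>: each factor is expanded around its own \<open>s_i\<close>.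
\<close>

lemma subst_poly_taylor:
  fixes x :: "('n::finite, 'a::field) mvpoly"
  shows "subst_poly x p = (\<Sum>j\<le>degree p. Const (taylor_coeff p a j) * (x - Const a) ^ j)"
proof -
  let ?q = "pcompose p [:a, 1:]"
  let ?Q = "map_poly Const ?q :: ('n, 'a) mvpoly poly"
  have "subst_poly x p = (\<Sum>j\<le>degree ?Q. coeff ?Q j * (x - Const a) ^ j)"
    unfolding subst_poly_shift[of x p a] by (simp add: subst_poly_def poly_altdef)
  also have "\<dots> = (\<Sum>j\<le>degree p. coeff ?Q j * (x - Const a) ^ j)"
  proof (rule sum.mono_neutral_left)
    have "degree ?Q \<le> degree ?q" by (rule map_poly_degree_leq)
    then show "{..degree ?Q} \<subseteq> {..degree p}" by (simp add: degree_pcompose)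
  qed (auto simp: coeff_eq_0)
  finally show ?thesis by (simp add: coeff_map_poly taylor_coeff_def)
qed

text \<open>
  Distributivity, with the choice functions packaged as exponent vectors; finite support is
  automatic over a finite index type.
\<close>

lemma prod_sum_exponents:
  fixes g :: "'n::finite \<Rightarrow> nat \<Rightarrow> 'b::comm_semiring_1"
  assumes "\<And>i. finite (B i)"
  shows "(\<Prod>i\<in>UNIV. \<Sum>k\<in>B i. g i k)
    = (\<Sum>u | \<forall>i. Poly_Mapping.lookup u i \<in> B i. \<Prod>i\<in>UNIV. g i (Poly_Mapping.lookup u i))"
proof -
  have "bij_betw Poly_Mapping.lookup {u. \<forall>i. Poly_Mapping.lookup u i \<in> B i} (PiE UNIV B)"
  proof (rule bij_betw_byWitness[where f' = Abs_poly_mapping])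
    show "\<forall>a'\<in>PiE UNIV B. Poly_Mapping.lookup (Abs_poly_mapping a') = a'"
      by (simp add: Abs_poly_mapping_inverse)
    then show "Abs_poly_mapping ` PiE UNIV B \<subseteq> {u. \<forall>i. Poly_Mapping.lookup u i \<in> B i}"
      by auto
  qed (auto simp: Poly_Mapping.lookup_inverse)
  then show ?thesis
    using assms by (simp add: prod_sum_PiE sum.reindex_bij_betw[symmetric])
qed

lemma finite_exponent_box:
  fixes B :: "'n::finite \<Rightarrow> nat set"
  assumes "\<And>i. finite (B i)"
  shows "finite {u. \<forall>i. Poly_Mapping.lookup u i \<in> B i}"
proof (rule inj_on_finite[of Poly_Mapping.lookup _ "PiE UNIV B"])
  show "inj_on Poly_Mapping.lookup {u. \<forall>i. Poly_Mapping.lookup u i \<in> B i}"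
    by (auto intro: inj_onI poly_mapping_eqI)
  show "finite (PiE UNIV B)" using assms by (simp add: finite_PiE)
qed auto

lemma shifted_coeff_shifted_sum: "shifted_coeff (shifted_sum s c) u s = Poly_Mapping.lookup c u"
  unfolding shifted_coeff_def
  using the1_equality[OF shifted_expansion_unique refl] by metis

definition sep_poly :: "('n::finite \<Rightarrow> 'a::field poly) \<Rightarrow> ('n, 'a) mvpoly" where
  "sep_poly p = (\<Prod>i\<in>UNIV. subst_poly (Var i) (p i))"

text \<open>
  Multiplying out the univariate Taylor expansions gives an expansion in powers of \<open>x - s\<close> with the
  stated coefficients, and such an expansion is unique.
\<close>

lemma shifted_coeff_sep_poly:
  "shifted_coeff (sep_poly p) u s
    = (\<Prod>i\<in>UNIV. taylor_coeff (p i) (s i) (Poly_Mapping.lookup u i))"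
proof -
  let ?c = "\<lambda>u. \<Prod>i\<in>UNIV. taylor_coeff (p i) (s i) (Poly_Mapping.lookup u i)"
  let ?B = "{u. \<forall>i. Poly_Mapping.lookup u i \<in> {..degree (p i)}}"
  have fin: "finite ?B" by (rule finite_exponent_box) simp
  define c where "c = (\<Sum>u\<in>?B. Poly_Mapping.single u (?c u))"
  have c: "Poly_Mapping.lookup c v = ?c v" for v
  proof -
    have "Poly_Mapping.lookup c v = (\<Sum>u\<in>?B. if v = u then ?c u else 0)"
      unfolding c_def lookup_sum by (intro sum.cong refl) (simp add: lookup_single when_def)
    also have "\<dots> = (if v \<in> ?B then ?c v else 0)"
      using fin by (simp add: sum.delta)
    also have "\<dots> = ?c v"
      by (auto simp: not_le intro: taylor_coeff_eq_0)
    finally show ?thesis .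
  qed
  have "sep_poly p = (\<Sum>u\<in>?B. Const (?c u) * shifted_monom s u)"
  proof -
    have "sep_poly p = (\<Prod>i\<in>UNIV. \<Sum>k\<in>{..degree (p i)}.
        Const (taylor_coeff (p i) (s i) k) * (Var i - Const (s i)) ^ k)"
      unfolding sep_poly_def by (intro prod.cong refl subst_poly_taylor)
    then show ?thesis
      by (subst (asm) prod_sum_exponents)
        (simp_all add: prod.distrib Const_prod shifted_monom_def)
  qed
  also have "\<dots> = shifted_sum s c"
  proof -
    have "Poly_Mapping.keys c \<subseteq> ?B"
    proof
      fix v assume "v \<in> Poly_Mapping.keys c"
      then have "?c v \<noteq> 0" by (simp add: in_keys_iff c)
      then have "\<forall>i. taylor_coeff (p i) (s i) (Poly_Mapping.lookup v i) \<noteq> 0"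
        by simp
      then show "v \<in> ?B" using taylor_coeff_eq_0 by (force simp flip: not_less)
    qed
    from shifted_sum_superset[OF fin this] show ?thesis by (simp add: c)
  qed
  finally show ?thesis by (simp add: shifted_coeff_shifted_sum c)
qed

lemma Var_power: "Var i ^ k = Poly_Mapping.single (Poly_Mapping.single i k) 1"
  by (induction k) (simp_all add: Var_def mult_single flip: single_add)

lemma prod_single:
  fixes f :: "'i \<Rightarrow> 'b::comm_monoid_add"
  shows "(\<Prod>i\<in>I. Poly_Mapping.single (f i) 1) = Poly_Mapping.single (\<Sum>i\<in>I. f i)
    (1 :: 'c::comm_semiring_1)"
  by (induction I rule: infinite_finite_induct) (simp_all add: mult_single)

lemma shifted_monom_0: "shifted_monom (\<lambda>_. 0) u = Poly_Mapping.single u 1"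
  by (simp add: shifted_monom_def Var_power prod_single sum_single_lookup)

text \<open>
  The expansion around the origin is the polynomial itself. This decomposes a polynomial into
  monomials and also makes ordinary coefficients the case \<open>s = 0\<close> of shifted ones.
\<close>

lemma shifted_sum_0: "shifted_sum (\<lambda>_. 0) f = f"
proof (rule poly_mapping_eqI)
  fix v
  have "Poly_Mapping.lookup (shifted_sum (\<lambda>_. 0) f) v
      = (\<Sum>u\<in>Poly_Mapping.keys f. if v = u then Poly_Mapping.lookup f u else 0)"
    unfolding shifted_sum_def lookup_sum lookup_Const_mult shifted_monom_0
    by (intro sum.cong refl) (simp add: lookup_single when_def)
  then show "Poly_Mapping.lookup (shifted_sum (\<lambda>_. 0) f) v = Poly_Mapping.lookup f v"
    by (simp add: sum.delta in_keys_iff)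
qed

lemma lookup_sep_poly:
  "Poly_Mapping.lookup (sep_poly p) u = (\<Prod>i\<in>UNIV. coeff (p i) (Poly_Mapping.lookup u i))"
  using shifted_coeff_sep_poly[of p u "\<lambda>_. 0"]
    shifted_coeff_shifted_sum[of "\<lambda>_. 0" "sep_poly p" u]
  by (simp add: shifted_sum_0 taylor_coeff_0)

lemma total_degree_sep_poly: "total_degree (sep_poly p) \<le> (\<Sum>i\<in>UNIV. degree (p i))"
proof -
  have "exp_sum v \<le> (\<Sum>i\<in>UNIV. degree (p i))" if "v \<in> Poly_Mapping.keys (sep_poly p)" for v
    unfolding exp_sum_def using that
    by (intro sum_mono le_degree) (simp add: in_keys_iff lookup_sep_poly)
  then show ?thesis by (simp add: total_degree_def)
qed

lemma shifted_coeff_linear_combination: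
  assumes "finite K"
  shows "shifted_coeff (\<Sum>k\<in>K. Const (a k) * f k) u s = (\<Sum>k\<in>K. a k * shifted_coeff (f k) u s)"
proof -
  have mult: "shifted_coeff (Const b * g) u s = b * shifted_coeff g u s" for b g
  proof -
    obtain c where c: "g = shifted_sum s c" using shifted_expansion_unique by blast
    have keys: "Poly_Mapping.keys (Const b * c) \<subseteq> Poly_Mapping.keys c"
      by (auto simp: in_keys_iff lookup_Const_mult)
    have "shifted_sum s (Const b * c) = Const b * g"
      by (subst shifted_sum_superset[OF finite_keys keys])
        (simp add: c shifted_sum_def lookup_Const_mult Const_mult sum_distrib_left mult.assoc)
    then show ?thesis
      using shifted_coeff_shifted_sum[of s "Const b * c" u] shifted_coeff_shifted_sum[of s c u]
      by (simp add: lookup_Const_mult c)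
  qed
  have add: "shifted_coeff (g + h) u s = shifted_coeff g u s + shifted_coeff h u s" for g h
  proof -
    obtain c d where "g = shifted_sum s c" "h = shifted_sum s d"
      using shifted_expansion_unique by metis
    then show ?thesis
      by (simp add: shifted_coeff_shifted_sum lookup_add flip: shifted_sum_add)
  qed
  have zero: "shifted_coeff 0 u s = 0"
    using mult[of 0 0] by simp
  show ?thesis
    using assms by induction (simp_all add: zero add mult)
qed

lemma exp_sum_less:
  assumes "\<And>i. Poly_Mapping.lookup u i \<le> Poly_Mapping.lookup v i" and "u \<noteq> v"
  shows "exp_sum u < exp_sum v"
proof -
  obtain j where "Poly_Mapping.lookup u j \<noteq> Poly_Mapping.lookup v j"
    using assms(2) poly_mapping_eqI by metis
  with assms(1) show ?thesis
    unfolding exp_sum_def by (intro sum_strict_mono_ex1) (auto simp: order.strict_iff_order)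
qed

section \<open>Existence\<close>

lemma sum_grid_below_mult:
  fixes g :: "'n::finite \<Rightarrow> 'a \<Rightarrow> nat \<Rightarrow> 'b::comm_semiring_1"
  shows "(\<Sum>s\<in>grid M. \<Sum>u\<in>below_mult M s. \<Prod>i\<in>UNIV. g i (s i) (Poly_Mapping.lookup u i))
    = (\<Prod>i\<in>UNIV. \<Sum>a\<in>set_mset (M i). \<Sum>j<count (M i) a. g i a j)"
proof -
  have "(\<Sum>u\<in>below_mult M s. \<Prod>i\<in>UNIV. g i (s i) (Poly_Mapping.lookup u i))
      = (\<Prod>i\<in>UNIV. \<Sum>j<count (M i) (s i). g i (s i) j)" for s
    using prod_sum_exponents[of "\<lambda>i. {..<count (M i) (s i)}" "\<lambda>i. g i (s i)"]
    by (simp add: below_mult_def)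
  moreover have "grid M = PiE UNIV (\<lambda>i. set_mset (M i))"
    by (simp add: grid_def PiE_def)
  ultimately show ?thesis
    by (simp add: prod_sum_PiE)
qed

text \<open>
  For a monomial \<open>x^v\<close> both sides factor over the variables. The univariate formulas apply to the
  factors with \<open>v_i \<le> t_i\<close>: if \<open>v = t\<close> these are all of them, and otherwise the degree bound
  leaves a factor with \<open>v_i < t_i\<close>, which is zero on both sides.
\<close>

lemma coefficient_formula_product:
  fixes M :: "'n::finite \<Rightarrow> 'a::field multiset"
  assumes nonempty: "\<And>i. M i \<noteq> {#}"
    and t: "\<And>i. Poly_Mapping.lookup t i = size (M i) - 1"
    and \<alpha>: "\<And>i p. degree p < size (M i) \<Longrightarrow> coeff p (size (M i) - 1)
      = (\<Sum>a\<in>set_mset (M i). \<Sum>j<count (M i) a. \<alpha> i a j * taylor_coeff p a j)"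
  shows "coefficient_formula M t (\<lambda>s u. \<Prod>i\<in>UNIV. \<alpha> i (s i) (Poly_Mapping.lookup u i))"
  unfolding coefficient_formula_def
proof (intro allI impI)
  let ?\<alpha> = "\<lambda>s u. \<Prod>i\<in>UNIV. \<alpha> i (s i) (Poly_Mapping.lookup u i)"
  let ?X = "\<lambda>v :: 'n \<Rightarrow>\<^sub>0 nat. sep_poly (\<lambda>i. monom 1 (Poly_Mapping.lookup v i)) :: ('n, 'a) mvpoly"
  fix f :: "('n, 'a) mvpoly"
  assume deg: "total_degree f \<le> exp_sum t"
  have size: "Poly_Mapping.lookup t i < size (M i)" for i
    using nonempty[of i] by (simp add: t nonempty_has_size)
  have monomial: "(\<Sum>s\<in>grid M. \<Sum>u\<in>below_mult M s. ?\<alpha> s u * shifted_coeff (?X v) u s)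
      = Poly_Mapping.lookup (?X v) t" if v: "exp_sum v \<le> exp_sum t" for v
  proof -
    let ?p = "\<lambda>i. monom 1 (Poly_Mapping.lookup v i) :: 'a poly"
    let ?R = "\<lambda>i. \<Sum>a\<in>set_mset (M i). \<Sum>j<count (M i) a. \<alpha> i a j * taylor_coeff (?p i) a j"
    have "(\<Sum>s\<in>grid M. \<Sum>u\<in>below_mult M s. ?\<alpha> s u * shifted_coeff (?X v) u s) = (\<Prod>i\<in>UNIV. ?R i)"
      unfolding sum_grid_below_mult[symmetric] shifted_coeff_sep_poly prod.distrib ..
    also have "\<dots> = (\<Prod>i\<in>UNIV. coeff (?p i) (Poly_Mapping.lookup t i))"
    proof (cases "v = t")
      case True
      have "?R i = coeff (?p i) (Poly_Mapping.lookup t i)" for i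
        using \<alpha>[of "?p i" i] size[of i] by (simp add: True t degree_monom_eq)
      then show ?thesis by simp
    next
      case False
      obtain i where i: "Poly_Mapping.lookup v i < Poly_Mapping.lookup t i"
      proof (rule ccontr)
        assume "\<not> thesis"
        then have le: "Poly_Mapping.lookup t i \<le> Poly_Mapping.lookup v i" for i
          using that not_le by blast
        then have "exp_sum t < exp_sum v" using False[symmetric] by (rule exp_sum_less)
        with v show False by simp
      qed
      have "?R i = coeff (?p i) (Poly_Mapping.lookup t i)"
        using \<alpha>[of "?p i" i] size[of i] i by (simp add: t degree_monom_eq)
      also have "\<dots> = 0" using i by simp
      finally have "?R i = 0" .
      moreover have "coeff (?p i) (Poly_Mapping.lookup t i) = 0" using i by simp
      ultimately show ?thesis
        by (metis (no_types, lifting) UNIV_I finite prod_zero)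
    qed
    finally show ?thesis by (simp add: lookup_sep_poly)
  qed
  let ?K = "Poly_Mapping.keys f"
  have f: "f = (\<Sum>v\<in>?K. Const (Poly_Mapping.lookup f v) * ?X v)"
    by (subst shifted_sum_0[of f, symmetric])
      (simp add: shifted_sum_def shifted_monom_def sep_poly_def subst_poly_monom)
  have "Poly_Mapping.lookup f t
      = (\<Sum>v\<in>?K. Poly_Mapping.lookup f v * Poly_Mapping.lookup (?X v) t)"
    by (subst f) (simp add: lookup_sum lookup_Const_mult)
  also have "\<dots> = (\<Sum>v\<in>?K. \<Sum>s\<in>grid M. \<Sum>u\<in>below_mult M s.
      Poly_Mapping.lookup f v * (?\<alpha> s u * shifted_coeff (?X v) u s))"
  proof (rule sum.cong)
    fix v assume "v \<in> ?K"
    then have "exp_sum v \<le> exp_sum t"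
      using deg by (simp add: total_degree_def)
    then show "Poly_Mapping.lookup f v * Poly_Mapping.lookup (?X v) t = (\<Sum>s\<in>grid M.
        \<Sum>u\<in>below_mult M s. Poly_Mapping.lookup f v * (?\<alpha> s u * shifted_coeff (?X v) u s))"
      by (simp only: monomial[symmetric] sum_distrib_left)
  qed simp
  also have "\<dots> = (\<Sum>s\<in>grid M. \<Sum>u\<in>below_mult M s. \<Sum>v\<in>?K.
      Poly_Mapping.lookup f v * (?\<alpha> s u * shifted_coeff (?X v) u s))"
    by (simp only: sum.swap[of _ _ ?K])
  also have "\<dots> = (\<Sum>s\<in>grid M. \<Sum>u\<in>below_mult M s. ?\<alpha> s u * shifted_coeff f u s)"
  proof -
    have "shifted_coeff f u s
        = (\<Sum>v\<in>?K. Poly_Mapping.lookup f v * shifted_coeff (?X v) u s)" for u s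
      by (subst f) (rule shifted_coeff_linear_combination[OF finite_keys])
    then show ?thesis
      by (simp add: sum_distrib_left mult.left_commute)
  qed
  finally show "Poly_Mapping.lookup f t
      = (\<Sum>s\<in>grid M. \<Sum>u\<in>below_mult M s. ?\<alpha> s u * shifted_coeff f u s)" .
qed

section \<open>Uniqueness and nonvanishing\<close>

definition grid_test ::
  "('n::finite \<Rightarrow> 'a::field multiset) \<Rightarrow> ('n \<Rightarrow> 'a) \<Rightarrow> ('n \<Rightarrow>\<^sub>0 nat) \<Rightarrow> ('n, 'a) mvpoly" where
  "grid_test M s u = sep_poly (\<lambda>i. hermite_test (M i) (s i) (Poly_Mapping.lookup u i))"

lemma total_degree_grid_test:
  assumes "u \<in> below_mult M s" and t: "\<And>i. Poly_Mapping.lookup t i = size (M i) - 1"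
  shows "total_degree (grid_test M s u) \<le> exp_sum t"
proof -
  have "degree (hermite_test (M i) (s i) (Poly_Mapping.lookup u i)) \<le> Poly_Mapping.lookup t i" for i
  proof -
    have "Poly_Mapping.lookup u i < count (M i) (s i)"
      using assms(1) by (simp add: below_mult_def)
    then show ?thesis
      using degree_hermite_test[of "M i" "s i" "Poly_Mapping.lookup u i"] by (simp add: t)
  qed
  then show ?thesis
    unfolding grid_test_def exp_sum_def
    by (intro order_trans[OF total_degree_sep_poly] sum_mono)
qed

lemma lookup_grid_test_top:
  assumes s: "s \<in> grid M" and t: "\<And>i. Poly_Mapping.lookup t i = size (M i) - 1"
    and u: "\<And>i. Poly_Mapping.lookup u i = count (M i) (s i) - 1"
  shows "Poly_Mapping.lookup (grid_test M s u) t = 1"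
proof -
  have "coeff (hermite_test (M i) (s i) (Poly_Mapping.lookup u i)) (Poly_Mapping.lookup t i) = 1" for i
  proof -
    have "0 < count (M i) (s i)" using s by (auto simp: grid_def)
    then have "degree (hermite_test (M i) (s i) (Poly_Mapping.lookup u i)) = Poly_Mapping.lookup t i"
      using degree_hermite_test[of "M i" "s i" "Poly_Mapping.lookup u i"] by (simp add: t u)
    then show ?thesis using lead_coeff_hermite_test by metis
  qed
  then show ?thesis by (simp add: grid_test_def lookup_sep_poly)
qed

lemma shifted_coeff_grid_test_diag: "shifted_coeff (grid_test M s u) u s \<noteq> 0"
  by (simp add: grid_test_def shifted_coeff_sep_poly taylor_coeff_hermite_test_diag)

lemma shifted_coeff_grid_test_eq_0:
  assumes s': "s' \<in> grid M" and v: "v \<in> below_mult M s'"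
    and "s' \<noteq> s \<or> (\<exists>i. Poly_Mapping.lookup v i < Poly_Mapping.lookup u i)"
  shows "shifted_coeff (grid_test M s u) v s' = 0"
proof -
  have "\<exists>i. taylor_coeff (hermite_test (M i) (s i) (Poly_Mapping.lookup u i)) (s' i)
      (Poly_Mapping.lookup v i) = 0"
  proof (cases "s' = s")
    case True
    with assms(3) show ?thesis using taylor_coeff_hermite_test_below by blast
  next
    case False
    then obtain i where "s' i \<noteq> s i" by blast
    moreover have "s' i \<in># M i" "Poly_Mapping.lookup v i < count (M i) (s' i)"
      using s' v by (auto simp: grid_def below_mult_def)
    ultimately show ?thesis using taylor_coeff_hermite_test_other by blast
  qed
  then show ?thesis by (auto simp: grid_test_def shifted_coeff_sep_poly)
qed

text \<open>
  The test polynomial can only see \<open>\<gamma>\<close> at \<open>s\<close>, and there only at exponents that dominate \<open>u\<close>;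
  once \<open>\<gamma>\<close> is known to vanish at the larger ones, a single term is left.
\<close>

lemma sum_grid_test:
  assumes s: "s \<in> grid M" and u: "u \<in> below_mult M s"
    and \<gamma>: "\<And>v. v \<in> below_mult M s \<Longrightarrow>
      (\<And>i. Poly_Mapping.lookup u i \<le> Poly_Mapping.lookup v i) \<Longrightarrow> v \<noteq> u \<Longrightarrow> \<gamma> s v = 0"
  shows "(\<Sum>s'\<in>grid M. \<Sum>v\<in>below_mult M s'. \<gamma> s' v * shifted_coeff (grid_test M s u) v s')
    = \<gamma> s u * shifted_coeff (grid_test M s u) u s"
proof -
  let ?c = "shifted_coeff (grid_test M s u)"
  have "(\<Sum>s'\<in>grid M. \<Sum>v\<in>below_mult M s'. \<gamma> s' v * ?c v s')
      = (\<Sum>s'\<in>{s}. \<Sum>v\<in>below_mult M s'. \<gamma> s' v * ?c v s')"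
  proof (rule sum.mono_neutral_right[OF finite_grid])
    show "\<forall>s'\<in>grid M - {s}. (\<Sum>v\<in>below_mult M s'. \<gamma> s' v * ?c v s') = 0"
      by (intro ballI sum.neutral) (simp add: shifted_coeff_grid_test_eq_0)
  qed (use s in simp)
  also have "\<dots> = (\<Sum>v\<in>below_mult M s. \<gamma> s v * ?c v s)"
    by simp
  also have "\<dots> = (\<Sum>v\<in>{u}. \<gamma> s v * ?c v s)"
  proof (rule sum.mono_neutral_right[OF finite_below_mult])
    show "\<forall>v\<in>below_mult M s - {u}. \<gamma> s v * ?c v s = 0"
    proof
      fix v assume v: "v \<in> below_mult M s - {u}"
      show "\<gamma> s v * ?c v s = 0"
      proof (cases "\<exists>i. Poly_Mapping.lookup v i < Poly_Mapping.lookup u i")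
        case True
        then show ?thesis using v shifted_coeff_grid_test_eq_0[OF s] by simp
      next
        case False
        then show ?thesis using v \<gamma>[of v] by (simp add: not_less)
      qed
    qed
  qed (use u in simp)
  finally show ?thesis by simp
qed

text \<open>
  Otherwise test both formulas at an exponent \<open>w\<close> of maximal degree at which they differ at \<open>s\<close>.
  Exponents that properly dominate \<open>w\<close> have larger degree, so the constants agree there.
\<close>

lemma coefficient_formula_unique:
  assumes t: "\<And>i. Poly_Mapping.lookup t i = size (M i) - 1"
    and \<alpha>: "coefficient_formula M t \<alpha>" and \<beta>: "coefficient_formula M t \<beta>"
    and s: "s \<in> grid M" and "u \<in> below_mult M s"
  shows "\<alpha> s u = \<beta> s u"
proof (rule ccontr)
  assume "\<alpha> s u \<noteq> \<beta> s u"
  let ?N = "{v \<in> below_mult M s. \<alpha> s v \<noteq> \<beta> s v}"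
  have "finite ?N" using finite_below_mult by (rule finite_subset[rotated]) auto
  moreover have "?N \<noteq> {}" using assms(5) \<open>\<alpha> s u \<noteq> \<beta> s u\<close> by blast
  ultimately obtain w where w: "w \<in> ?N" and Max: "Max (exp_sum ` ?N) = exp_sum w"
    by (rule obtains_MAX)
  have max: "exp_sum v \<le> exp_sum w" if "v \<in> ?N" for v
    unfolding Max[symmetric] using \<open>finite ?N\<close> that by (intro Max_ge) auto
  let ?\<gamma> = "\<lambda>s u. \<alpha> s u - \<beta> s u" and ?f = "grid_test M s w"
  have "?\<gamma> s w * shifted_coeff ?f w s
      = (\<Sum>s'\<in>grid M. \<Sum>v\<in>below_mult M s'. ?\<gamma> s' v * shifted_coeff ?f v s')"
  proof (rule sum_grid_test[symmetric, OF s])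
    fix v assume v: "v \<in> below_mult M s" "v \<noteq> w"
      and le: "\<And>i. Poly_Mapping.lookup w i \<le> Poly_Mapping.lookup v i"
    have "exp_sum w < exp_sum v" using le v(2)[symmetric] by (rule exp_sum_less)
    with max v(1) show "\<alpha> s v - \<beta> s v = 0" by force
  qed (use w in simp)
  also have "\<dots> = 0"
  proof -
    have "total_degree ?f \<le> exp_sum t"
      using w by (intro total_degree_grid_test t) simp
    with \<alpha> \<beta> show ?thesis
      unfolding coefficient_formula_def by (simp add: left_diff_distrib sum_subtractf)
  qed
  finally show False
    using w by (simp add: shifted_coeff_grid_test_diag)
qed

text \<open>
  Nothing below \<open>m(s)\<close> properly dominates \<open>m(s) - 1\<close>, so \<open>sum_grid_test\<close> applies to \<open>\<alpha>\<close> itself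
  and leaves \<open>1 = \<alpha> s u * c\<close>, where \<open>c\<close> is a coefficient of the test polynomial.
\<close>

lemma coefficient_formula_top_nonzero:
  assumes t: "\<And>i. Poly_Mapping.lookup t i = size (M i) - 1"
    and \<alpha>: "coefficient_formula M t \<alpha>"
    and s: "s \<in> grid M" and top: "\<And>i. Poly_Mapping.lookup u i = count (M i) (s i) - 1"
  shows "\<alpha> s u \<noteq> 0"
proof -
  let ?f = "grid_test M s u"
  have u: "u \<in> below_mult M s"
    using s by (simp add: below_mult_def grid_def top Pi_iff)
  have "1 = (\<Sum>s'\<in>grid M. \<Sum>v\<in>below_mult M s'. \<alpha> s' v * shifted_coeff ?f v s')"
  proof -
    have "1 = Poly_Mapping.lookup ?f t"
      by (rule lookup_grid_test_top[OF s t top, symmetric])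
    also have "\<dots> = (\<Sum>s'\<in>grid M. \<Sum>v\<in>below_mult M s'. \<alpha> s' v * shifted_coeff ?f v s')"
      using \<alpha> total_degree_grid_test[OF u t] unfolding coefficient_formula_def by blast
    finally show ?thesis .
  qed
  also have "\<dots> = \<alpha> s u * shifted_coeff ?f u s"
  proof (rule sum_grid_test[OF s u])
    fix v assume v: "v \<in> below_mult M s" "v \<noteq> u"
      and le: "\<And>i. Poly_Mapping.lookup u i \<le> Poly_Mapping.lookup v i"
    have "Poly_Mapping.lookup v i = Poly_Mapping.lookup u i" for i
    proof -
      have "Poly_Mapping.lookup v i < count (M i) (s i)"
        using v(1) by (simp add: below_mult_def)
      with le[of i] top[of i] show ?thesis by linarith
    qed
    then have "v = u" by (rule poly_mapping_eqI)
    with v(2) show "\<alpha> s v = 0" by simp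
  qed
  finally show ?thesis by auto
qed

theorem theorem9:
  fixes M :: "'n::finite \<Rightarrow> 'a::field multiset"
    and t :: "'n \<Rightarrow>\<^sub>0 nat"
  assumes nonempty: "\<And>i. M i \<noteq> {#}"
    and t: "\<And>i. Poly_Mapping.lookup t i = size (M i) - 1"
  shows "(\<exists>\<alpha>. coefficient_formula M t \<alpha>) \<and>
         (\<forall>\<alpha> \<beta>. coefficient_formula M t \<alpha> \<longrightarrow> coefficient_formula M t \<beta> \<longrightarrow>
            (\<forall>s\<in>grid M. \<forall>u\<in>below_mult M s. \<alpha> s u = \<beta> s u)) \<and>
         (\<forall>\<alpha>. coefficient_formula M t \<alpha> \<longrightarrow>
            (\<forall>s\<in>grid M. \<forall>u. (\<forall>i. Poly_Mapping.lookup u i = count (M i) (s i) - 1) \<longrightarrow> \<alpha> s u \<noteq> 0))"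
proof (intro conjI)
  have "\<forall>i. \<exists>\<alpha>. \<forall>p. degree p < size (M i) \<longrightarrow> coeff p (size (M i) - 1)
      = (\<Sum>a\<in>set_mset (M i). \<Sum>j<count (M i) a. \<alpha> a j * taylor_coeff p a j)"
    using univariate_coefficient_formula[OF nonempty] by blast
  then have "\<exists>\<alpha>. \<forall>i. \<forall>p. degree p < size (M i) \<longrightarrow> coeff p (size (M i) - 1)
      = (\<Sum>a\<in>set_mset (M i). \<Sum>j<count (M i) a. \<alpha> i a j * taylor_coeff p a j)"
    by (rule choice)
  then obtain \<alpha> where \<alpha>: "\<And>i p. degree p < size (M i) \<Longrightarrow> coeff p (size (M i) - 1)
      = (\<Sum>a\<in>set_mset (M i). \<Sum>j<count (M i) a. \<alpha> i a j * taylor_coeff p a j)"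
    by blast
  show "\<exists>\<alpha>. coefficient_formula M t \<alpha>"
    by (rule exI) (rule coefficient_formula_product[OF nonempty t \<alpha>])
next
  show "\<forall>\<alpha> \<beta>. coefficient_formula M t \<alpha> \<longrightarrow> coefficient_formula M t \<beta> \<longrightarrow>
      (\<forall>s\<in>grid M. \<forall>u\<in>below_mult M s. \<alpha> s u = \<beta> s u)"
    by (intro allI impI ballI) (rule coefficient_formula_unique[OF t])
next
  show "\<forall>\<alpha>. coefficient_formula M t \<alpha> \<longrightarrow> (\<forall>s\<in>grid M. \<forall>u.
      (\<forall>i. Poly_Mapping.lookup u i = count (M i) (s i) - 1) \<longrightarrow> \<alpha> s u \<noteq> 0)"
    by (intro allI impI ballI, rule coefficient_formula_top_nonzero[OF t]) auto
qed

end
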